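(* Let $A\in\mathbb{R}^{N\times N}$ be symmetric positive definite with all eigenvalues in the interval $[\alpha,\beta]$, where $0<\alpha<\beta$, let $v\in\mathbb{R}^N$, and set $$\eta=\rho^2,\quad \nu=\frac{2\rho}{\delta},\quad \rho=\frac{\alpha+\beta}{\beta-\alpha}-\sqrt{\left(\frac{\alpha+\beta}{\beta-\alpha}\right)^2-1},\quad \delta=\frac{\alpha+\beta}{2},\quad \widehat{\nu}=\frac{N}{\mathbb{E}[T]}\nu.$$ Define the $2N\times 2N$ matrices and the vector in $\mathbb{R}^{2N}$ $$C=\begin{bmatrix}(1+\eta)I-\nu A&-\eta I\\ I&0\end{bmatrix},\qquad \widehat{C}_i=\begin{bmatrix}(1+\eta)I-\widehat{\nu}D_{{\cal T}_i}A&-\eta I\\ I&0\end{bmatrix},\qquad b=\nu\begin{bmatrix}v\\0\end{bmatrix},$$ and the iterations $d_i=Cd_{i-1}+b$ and $\widehat{d}_i=\widehat{C}_i\widehat{d}_{i-1}+b$ for $i=1,2,\ldots$, with starting vectors $d_0,\widehat{d}_0\in\mathbb{R}^{2N}$. Then for every $m\ge 1$, $$d_m=C^md_0+\left[C^{m-1}+\cdots+C+I\right]b,$$ and $$\widehat{d}_m=\prod_{i=1}^{m}\widehat{C}_i\,\widehat{d}_0+\left[\prod_{i=2}^{m}\widehat{C}_i+\cdots+\widehat{C}_m+I\right]b.$$ Moreover, if $\widehat{d}_0=d_0=f$ for some $f\in\mathbb{R}^{2N}$, then $$\mathbb{E}\left[\widehat{d}_m\right]=d_m.$$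
   Context: $T$ is a random integer with an arbitrary distribution on $\{1,\ldots,N\}$, and ${\cal T}$ is a random subset of $\{1,\ldots,N\}$ with $|{\cal T}|=T$ such that, conditionally on $T=t$, each of the $\binom{N}{t}$ subsets of cardinality $t$ is chosen with probability $\binom{N}{t}^{-1}$. The pairs $(T_1,{\cal T}_1),(T_2,{\cal T}_2),\ldots$ are independent and identically distributed copies of $(T,{\cal T})$. $e_j$ is the $j$th column of the $N\times N$ identity matrix and $D_{{\cal T}_i}=\sum_{j\in{\cal T}_i}e_je_j^{\top}$. In the block matrices, $I$ and $0$ denote the $N\times N$ identity and zero blocks; in the bracketed sums $I$ is the $2N\times 2N$ identity. The data $A,v,\alpha,\beta,f$ are deterministic. Products of matrices are ordered with higher indices to the left: $\prod_{i=j}^{m}\widehat{C}_i=\widehat{C}_m\widehat{C}_{m-1}\cdots\widehat{C}_j$; the bracketed sum for $\widehat{d}_m$ is $I+\sum_{j=2}^{m}\prod_{i=j}^{m}\widehat{C}_i$, and for $m=1$ both bracketed sums equal $I$. The first iteration is the block form of the stationary Chebyshev semi-iterative method $z_m=z_{m-1}+\eta(z_{m-1}-z_{m-2})+\nu(v-Az_{m-1})$, with $d_m=[z_m;z_{m-1}]$, and the second is its straggler-tolerant version $\widehat{z}_m=\widehat{z}_{m-1}+\eta(\widehat{z}_{m-1}-\widehat{z}_{m-2})+\nu v-\widehat{\nu}D_{{\cal T}_m}A\widehat{z}_{m-1}$, with $\widehat{d}_m=[\widehat{z}_m;\widehat{z}_{m-1}]$. *)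

theory Defs
  imports "HOL-Probability.Probability"
begin

text \<open>
  The index set \<open>{1, \<dots>, N}\<close> is the finite type \<open>'n\<close> with \<open>N = CARD('n)\<close>; vectors and matrices of
  size \<open>2N\<close> are indexed by \<open>'n + 'n\<close>, where \<open>Inl\<close> gives the first and \<open>Inr\<close> the second block.
\<close>

definition sym_pos_def :: "real^'n^'n \<Rightarrow> bool" where
  "sym_pos_def A \<longleftrightarrow> transpose A = A \<and> (\<forall>x. x \<noteq> 0 \<longrightarrow> x \<bullet> (A *v x) > 0)"

definition eigenvalue :: "real^'n^'n \<Rightarrow> real \<Rightarrow> bool" where
  "eigenvalue A l \<longleftrightarrow> (\<exists>x. x \<noteq> 0 \<and> A *v x = l *\<^sub>R x)"

definition sel_matrix :: "'n set \<Rightarrow> real^'n^'n" where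
  "sel_matrix S = (\<Sum>j\<in>S. (columnvector (axis j 1 :: real^'n) :: real^1^'n) ** rowvector (axis j 1 :: real^'n))"

definition block_matrix ::
    "real^'n^'n \<Rightarrow> real^'n^'n \<Rightarrow> real^'n^'n \<Rightarrow> real^'n^'n \<Rightarrow> real^('n + 'n)^('n + 'n)" where
  "block_matrix P Q R S = (\<chi> i j.
     (case (i, j) of
        (Inl k, Inl l) \<Rightarrow> P $ k $ l
      | (Inl k, Inr l) \<Rightarrow> Q $ k $ l
      | (Inr k, Inl l) \<Rightarrow> R $ k $ l
      | (Inr k, Inr l) \<Rightarrow> S $ k $ l))"

definition block_vec :: "real^'n \<Rightarrow> real^'n \<Rightarrow> real^('n + 'n)" where
  "block_vec u w = (\<chi> i. (case i of Inl k \<Rightarrow> u $ k | Inr k \<Rightarrow> w $ k))"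

text \<open>On type \<open>vec\<close> the library operations \<open>*\<close>, \<open>1\<close> and \<open>^\<close> act componentwise.\<close>

primrec matpow :: "real^'k^'k \<Rightarrow> nat \<Rightarrow> real^'k^'k" where
  "matpow X 0 = mat 1"
| "matpow X (Suc n) = X ** matpow X n"

text \<open>\<open>matprod X j m = X m ** \<dots> ** X (j + 1) ** X j\<close>, higher indices to the left.\<close>

definition matprod :: "(nat \<Rightarrow> real^'k^'k) \<Rightarrow> nat \<Rightarrow> nat \<Rightarrow> real^'k^'k" where
  "matprod X j m = foldl (\<lambda>P i. X i ** P) (mat 1) [j..<Suc m]"

text \<open>
  \<open>T\<close> is a random integer in \<open>{1, \<dots>, N}\<close> and \<open>S\<close> is a random subset with \<open>T\<close> elements, uniformly
  distributed among the subsets of cardinality \<open>t\<close> given \<open>T = t\<close>. The distribution of \<open>T\<close> is arbitrary,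
  so only those \<open>t\<close> with positive probability are conditioned on.
\<close>

definition uniform_random_subset ::
    "'w measure \<Rightarrow> ('w \<Rightarrow> nat) \<Rightarrow> ('w \<Rightarrow> 'n::finite set) \<Rightarrow> bool" where
  "uniform_random_subset M T S \<longleftrightarrow>
     T \<in> measurable M (count_space UNIV) \<and>
     S \<in> measurable M (count_space UNIV) \<and>
     (AE \<omega> in M. T \<omega> \<in> {1..CARD('n)} \<and> card (S \<omega>) = T \<omega>) \<and>
     (\<forall>t U. \<P>(\<omega> in M. T \<omega> = t) > 0 \<longrightarrow> card U = t \<longrightarrow>
        \<P>(\<omega> in M. S \<omega> = U \<bar> T \<omega> = t) = 1 / real (CARD('n) choose t))"

text \<open>The pairs \<open>(Ts i, Ss i)\<close>, \<open>i \<ge> 1\<close>, are independent copies of \<open>(T, S)\<close>.\<close>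

definition iid_copies ::
    "'w measure \<Rightarrow> ('w \<Rightarrow> nat) \<Rightarrow> ('w \<Rightarrow> 'n set) \<Rightarrow> (nat \<Rightarrow> 'w \<Rightarrow> nat) \<Rightarrow> (nat \<Rightarrow> 'w \<Rightarrow> 'n set) \<Rightarrow> bool" where
  "iid_copies M T S Ts Ss \<longleftrightarrow>
     prob_space.indep_vars M (\<lambda>_. count_space UNIV) (\<lambda>i \<omega>. (Ts i \<omega>, Ss i \<omega>)) {1..} \<and>
     (\<forall>i\<ge>1. distr M (count_space UNIV) (\<lambda>\<omega>. (Ts i \<omega>, Ss i \<omega>))
           = distr M (count_space UNIV) (\<lambda>\<omega>. (T \<omega>, S \<omega>)))"

end

theory Submission
  imports Defs
begin

text \<open>
  Both iterations are affine recursions \<open>y\<^sub>i = X\<^sub>i y\<^sub>i\<^sub>-\<^sub>1 + b\<close>, and the two closed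
  forms are one formula, \<open>affine_orbit_closed_form\<close>, with random and with constant coefficients.

  The expectations agree for two reasons. The random coefficients have the right mean: exchanging
  two indices preserves the law of a uniform random subset, so every index is selected with the
  same probability, which is \<open>E[T] / N\<close> because these probabilities add up to the expected
  cardinality (\<open>uniform_random_subset_inclusion_prob\<close>). The factor \<open>N / E[T]\<close> in the step
  size cancels it, and since the block matrix is affine in the selection matrix, its mean is
  \<open>C\<close> (\<open>expectation_straggler_block_matrix\<close>). Moreover, the state after \<open>m\<close> steps is a
  function of the first \<open>m\<close> coefficients and so is independent of the next coefficient. The
  expectation of their product is therefore the product of their expectations, and the expected
  state follows the recursion of the expected coefficients (\<open>expectation_affine_orbit\<close>).
\<close>

section \<open>Vector-valued random variables\<close>

lemma borel_measurable_vec_iff: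
  fixes f :: "'a \<Rightarrow> 'b::euclidean_space^'n"
  shows "f \<in> borel_measurable M \<longleftrightarrow> (\<forall>i. (\<lambda>x. f x $ i) \<in> borel_measurable M)"
proof
  assume f: "f \<in> borel_measurable M"
  have "(\<lambda>v. v $ i) \<in> borel_measurable (borel :: ('b^'n) measure)" for i
    by (intro borel_measurable_continuous_onI linear_continuous_on bounded_linear_vec_nth)
  from measurable_compose[OF f this]
  show "\<forall>i. (\<lambda>x. f x $ i) \<in> borel_measurable M" by blast
next
  assume "\<forall>i. (\<lambda>x. f x $ i) \<in> borel_measurable M"
  then show "f \<in> borel_measurable M"
    by (subst borel_measurable_euclidean_space) (auto simp: Basis_vec_def inner_axis intro!: borel_measurable_inner)
qed

lemma integrable_vec_iff:
  fixes f :: "'a \<Rightarrow> 'b::euclidean_space^'n"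
  shows "integrable M f \<longleftrightarrow> (\<forall>i. integrable M (\<lambda>x. f x $ i))"
proof
  assume "integrable M f"
  then show "\<forall>i. integrable M (\<lambda>x. f x $ i)"
    by (auto intro: integrable_bounded_linear[OF bounded_linear_vec_nth])
next
  assume *: "\<forall>i. integrable M (\<lambda>x. f x $ i)"
  have "bounded_linear (axis i :: 'b \<Rightarrow> 'b^'n)" for i
    by (intro linear_conv_bounded_linear[THEN iffD1] linearI) (auto simp: axis_def vec_eq_iff)
  then have "integrable M (\<lambda>x. axis i (f x $ i) :: 'b^'n)" for i
    by (rule integrable_bounded_linear) (use * in auto)
  then have "integrable M (\<lambda>x. \<Sum>i\<in>UNIV. axis i (f x $ i) :: 'b^'n)"
    by auto
  moreover have "(\<Sum>i\<in>UNIV. axis i (v $ i)) = v" for v :: "'b^'n"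
    by (simp add: vec_eq_iff axis_def if_distrib sum.If_cases)
  ultimately show "integrable M f" by simp
qed

lemma integral_vec_nth:
  fixes f :: "'a \<Rightarrow> 'b::euclidean_space^'n"
  assumes "integrable M f"
  shows "integral\<^sup>L M f $ i = (LINT x|M. f x $ i)"
  using integral_bounded_linear[OF bounded_linear_vec_nth assms] by simp

text \<open>
  Entrywise independence is what bilinearity uses, and it allows \<open>X\<close> and \<open>Y\<close> to have
  different types, which \<^const>\<open>prob_space.indep_var\<close> does not.
\<close>

lemma (in prob_space) expectation_indep_matrix_vector_mult:
  fixes X :: "'a \<Rightarrow> real^'k^'l" and Y :: "'a \<Rightarrow> real^'k"
  assumes ind: "\<And>i j. indep_var borel (\<lambda>\<omega>. X \<omega> $ i $ j) borel (\<lambda>\<omega>. Y \<omega> $ j)"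
    and X: "integrable M X" and Y: "integrable M Y"
  shows "integrable M (\<lambda>\<omega>. X \<omega> *v Y \<omega>)"
    and "expectation (\<lambda>\<omega>. X \<omega> *v Y \<omega>) = expectation X *v expectation Y"
proof -
  have intX: "integrable M (\<lambda>\<omega>. X \<omega> $ i)" "integrable M (\<lambda>\<omega>. X \<omega> $ i $ j)"
    and intY: "integrable M (\<lambda>\<omega>. Y \<omega> $ j)" for i j
    using X Y by (simp_all add: integrable_vec_iff)
  have prod: "integrable M (\<lambda>\<omega>. X \<omega> $ i $ j * Y \<omega> $ j)" for i j
    by (rule indep_var_integrable[OF ind intX(2) intY])
  then show int: "integrable M (\<lambda>\<omega>. X \<omega> *v Y \<omega>)"
    by (subst integrable_vec_iff) (simp add: matrix_vector_mult_def)
  show "expectation (\<lambda>\<omega>. X \<omega> *v Y \<omega>) = expectation X *v expectation Y"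
    using prod indep_var_lebesgue_integral[OF ind intX(2) intY]
    by (simp add: vec_eq_iff integral_vec_nth[OF int])
       (simp add: matrix_vector_mult_def integral_vec_nth X Y intX)
qed

section \<open>Affine recursions\<close>

text \<open>
  Both iterations of the theorem are instances: the stationary one has constant coefficients,
  and the straggler-tolerant one has random coefficients, with one orbit for each outcome.
\<close>

primrec affine_orbit :: "(nat \<Rightarrow> real^'k^'k) \<Rightarrow> real^'k \<Rightarrow> real^'k \<Rightarrow> nat \<Rightarrow> real^'k" where
  "affine_orbit X c f 0 = f"
| "affine_orbit X c f (Suc m) = X (Suc m) *v affine_orbit X c f m + c"

lemma affine_orbitI:
  assumes "y 0 = f" "\<And>i. i \<ge> 1 \<Longrightarrow> y i = X i *v y (i - 1) + c"
  shows "y m = affine_orbit X c f m"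
  by (induction m) (use assms in auto)

lemma matprod_Suc: "j \<le> Suc m \<Longrightarrow> matprod X j (Suc m) = X (Suc m) ** matprod X j m"
  by (simp add: matprod_def)

lemma matprod_empty: "m < j \<Longrightarrow> matprod X j m = mat 1"
  by (simp add: matprod_def)

lemma matprod_const: "matprod (\<lambda>_. P) j (j + k - 1) = matpow P k" if "j \<ge> 1"
  using that
proof (induction k)
  case (Suc k)
  then show ?case
    using matprod_Suc[of j "j + k - 1" "\<lambda>_. P"] by simp
qed (simp add: matprod_empty)

lemma matrix_mult_sum_right:
  fixes P :: "real^'k^'k"
  shows "P ** (\<Sum>j\<in>J. Q j) = (\<Sum>j\<in>J. P ** Q j)"
  by (induction J rule: infinite_finite_induct) (auto simp: matrix_add_ldistrib)

text \<open>
  Unrolling the recursion: the input \<open>c\<close> injected at step \<open>j - 1\<close> is multiplied by the later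
  coefficients \<open>X j, \<dots>, X m\<close>. The last input is multiplied by none of them, which is the
  empty product at \<open>j = Suc m\<close>.
\<close>

lemma affine_orbit_closed_form:
  "affine_orbit X c f m = matprod X 1 m *v f + (\<Sum>j=2..Suc m. matprod X j m) *v c"
proof (induction m)
  case (Suc m)
  have "(\<Sum>j=2..Suc (Suc m). matprod X j (Suc m))
      = X (Suc m) ** (\<Sum>j=2..Suc m. matprod X j m) + mat 1"
    by (simp add: matprod_Suc matprod_empty matrix_mult_sum_right matrix_add_ldistrib)
  then show ?case
    by (simp add: Suc matprod_Suc matrix_vector_right_distrib matrix_vector_mult_add_rdistrib
        flip: matrix_vector_mul_assoc)
qed (simp add: matprod_empty)

lemma affine_orbit_const:
  "affine_orbit (\<lambda>_. P) c f m = matpow P m *v f + (\<Sum>k<m. matpow P k) *v c"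
proof -
  have "(\<Sum>j=2..Suc m. matprod (\<lambda>_. P) j m) = (\<Sum>k<m. matpow P k)"
  proof (rule sum.reindex_bij_witness[where i = "\<lambda>k. Suc m - k" and j = "\<lambda>j. Suc m - j"])
    fix j assume "j \<in> {2..Suc m}"
    then show "matpow P (Suc m - j) = matprod (\<lambda>_. P) j m"
      using matprod_const[of j P "Suc m - j"] by simp
  qed auto
  then show ?thesis
    using matprod_const[of 1 P m] by (simp add: affine_orbit_closed_form)
qed

lemma borel_measurable_affine_orbit:
  fixes c f :: "real^'k"
  assumes "{1..m} \<subseteq> J"
  shows "(\<lambda>x. affine_orbit x c f m) \<in> borel_measurable (PiM J (\<lambda>_. borel))"
  using assms
proof (induction m)
  case (Suc m)
  then have "{1..m} \<subseteq> J" by auto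
  have "(\<lambda>x. x (Suc m)) \<in> measurable (PiM J (\<lambda>_. borel)) (borel :: (real^'k^'k) measure)"
    using Suc.prems by (intro measurable_component_singleton) auto
  then have "(\<lambda>x. x (Suc m) $ i $ j) \<in> borel_measurable (PiM J (\<lambda>_. borel :: (real^'k^'k) measure))" for i j
    by (simp add: borel_measurable_vec_iff)
  moreover have "(\<lambda>x. affine_orbit x c f m $ j) \<in> borel_measurable (PiM J (\<lambda>_. borel))" for j
    using Suc.IH \<open>{1..m} \<subseteq> J\<close> by (simp add: borel_measurable_vec_iff)
  ultimately show ?case
    by (subst borel_measurable_vec_iff) (simp add: matrix_vector_mult_def)
qed simp

lemma affine_orbit_cong:
  "(\<And>i. i \<in> {1..m} \<Longrightarrow> X i = Y i) \<Longrightarrow> affine_orbit X c f m = affine_orbit Y c f m"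
  by (induction m) auto

text \<open>
  The current state is a function of the earlier coefficients, hence independent of the next one,
  so the expectation of their product factors.
\<close>

lemma (in prob_space) expectation_affine_orbit:
  fixes X :: "nat \<Rightarrow> 'a \<Rightarrow> real^'k^'k"
  assumes ind: "indep_vars (\<lambda>_. borel) X {1..}"
    and int: "\<And>i. i \<ge> 1 \<Longrightarrow> integrable M (X i)"
  shows "integrable M (\<lambda>\<omega>. affine_orbit (\<lambda>i. X i \<omega>) c f m) \<and>
    expectation (\<lambda>\<omega>. affine_orbit (\<lambda>i. X i \<omega>) c f m)
      = affine_orbit (\<lambda>i. expectation (X i)) c f m"
proof (induction m)
  case 0
  then show ?case by (simp add: prob_space)
next
  case (Suc m)
  let ?Y = "\<lambda>\<omega>. affine_orbit (\<lambda>i. X i \<omega>) c f m"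
  have "indep_var (PiM {Suc m} (\<lambda>_. borel)) (\<lambda>\<omega>. restrict (\<lambda>i. X i \<omega>) {Suc m})
      (PiM {1..m} (\<lambda>_. borel)) (\<lambda>\<omega>. restrict (\<lambda>i. X i \<omega>) {1..m})"
    by (rule indep_var_restrict[OF ind]) auto
  note restrict = this
  have proj: "(\<lambda>x. x (Suc m) $ i $ j)
      \<in> borel_measurable (PiM {Suc m} (\<lambda>_. borel :: (real^'k^'k) measure))" for i j
    using measurable_component_singleton[of "Suc m" "{Suc m}" "\<lambda>_. borel :: (real^'k^'k) measure"]
    by (simp add: borel_measurable_vec_iff)
  have orbit: "(\<lambda>x. affine_orbit x c f m $ j)
      \<in> borel_measurable (PiM {1..m} (\<lambda>_. borel))" for j
    using borel_measurable_affine_orbit[where c = c and f = f, OF order_refl[of "{1..m}"]]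
    by (simp add: borel_measurable_vec_iff)
  have "affine_orbit (restrict (\<lambda>i. X i \<omega>) {1..m}) c f m = ?Y \<omega>" for \<omega>
    by (rule affine_orbit_cong) auto
  then have "indep_var borel (\<lambda>\<omega>. X (Suc m) \<omega> $ i $ j) borel (\<lambda>\<omega>. ?Y \<omega> $ j)" for i j
    using indep_var_compose[OF restrict proj[of i j] orbit[of j]] by (simp add: comp_def)
  from expectation_indep_matrix_vector_mult[OF this int conjunct1[OF Suc]] Suc
  show ?case by (simp add: prob_space)
qed

section \<open>Uniform random subsets\<close>

text \<open>
  All subsets of one cardinality have the same probability, so every index is equally likely to be
  selected: the transposition of two indices turns the subsets that contain the one into those that
  contain the other. The \<open>CARD('n)\<close> equal inclusion probabilities add up to the expected
  cardinality.
\<close>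

lemma (in prob_space) uniform_random_subset_inclusion_prob:
  fixes S :: "'a \<Rightarrow> 'n::finite set"
  assumes TS: "uniform_random_subset M T S"
  shows "\<P>(\<omega> in M. i \<in> S \<omega>) = expectation (\<lambda>\<omega>. real (T \<omega>)) / real CARD('n)"
proof -
  have [measurable]: "T \<in> measurable M (count_space UNIV)" "S \<in> measurable M (count_space UNIV)"
    and ae: "AE \<omega> in M. T \<omega> \<in> {1..CARD('n)} \<and> card (S \<omega>) = T \<omega>"
    and cond: "\<And>t U. \<P>(\<omega> in M. T \<omega> = t) > 0 \<Longrightarrow> card U = t \<Longrightarrow>
        \<P>(\<omega> in M. S \<omega> = U \<bar> T \<omega> = t) = 1 / real (CARD('n) choose t)"
    using TS unfolding uniform_random_subset_def by blast+
  \<comment> \<open>The probability of each single subset of cardinality \<open>t\<close>; values of \<open>t\<close> that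
    \<open>T\<close> does not take have \<open>g t = 0\<close>, so no conditioning on null events occurs.\<close>
  define g where "g t = \<P>(\<omega> in M. T \<omega> = t) / real (CARD('n) choose t)" for t
  have prob_S: "\<P>(\<omega> in M. S \<omega> = U) = g (card U)" for U
  proof -
    have "\<P>(\<omega> in M. S \<omega> = U) = \<P>(\<omega> in M. S \<omega> = U \<and> T \<omega> = card U)"
      using ae by (intro prob_eq_AE) (auto elim: eventually_mono)
    moreover have "\<P>(\<omega> in M. S \<omega> = U \<and> T \<omega> = card U) \<le> \<P>(\<omega> in M. T \<omega> = card U)"
      by (intro finite_measure_mono) auto
    moreover have "\<P>(\<omega> in M. S \<omega> = U \<and> T \<omega> = card U) = g (card U)"
      if "\<P>(\<omega> in M. T \<omega> = card U) > 0"
      using cond[OF that refl] that by (simp add: cond_prob_def g_def field_simps)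
    ultimately show ?thesis
      by (cases "\<P>(\<omega> in M. T \<omega> = card U) > 0") (auto simp: g_def not_less measure_le_0_iff)
  qed
  have incl: "\<P>(\<omega> in M. k \<in> S \<omega>) = (\<Sum>U\<in>{U. k \<in> U}. g (card U))" for k
  proof -
    have "\<P>(\<omega> in M. k \<in> S \<omega>) = (\<Sum>U\<in>{U. k \<in> U}. \<P>(\<omega> in M. S \<omega> = U))"
      by (rule prob_sum) auto
    then show ?thesis by (simp add: prob_S)
  qed
  have symm: "\<P>(\<omega> in M. k \<in> S \<omega>) = \<P>(\<omega> in M. i \<in> S \<omega>)" for k
  proof -
    define \<tau> where "\<tau> = Transposition.transpose i k"
    have [simp]: "\<tau> ` (\<tau> ` U) = U" "card (\<tau> ` U) = card U" for U
      by (auto simp: \<tau>_def image_comp card_image)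
    have "\<tau> i = k" "\<tau> k = i"
      by (simp_all add: \<tau>_def)
    then show ?thesis
      unfolding incl
      by (intro sum.reindex_bij_witness[where i = "image \<tau>" and j = "image \<tau>"]) force+
  qed
  have "expectation (\<lambda>\<omega>. real (T \<omega>)) = expectation (\<lambda>\<omega>. \<Sum>k\<in>UNIV. indicator {\<omega>\<in>space M. k \<in> S \<omega>} \<omega>)"
  proof (rule integral_cong_AE)
    show "AE \<omega> in M. real (T \<omega>) = (\<Sum>k\<in>UNIV. indicator {\<omega>\<in>space M. k \<in> S \<omega>} \<omega>)"
      using ae AE_space
    proof eventually_elim
      case (elim \<omega>)
      then have "(\<Sum>k\<in>UNIV. indicator {\<omega>\<in>space M. k \<in> S \<omega>} \<omega>) = real (card (S \<omega>))"
        by (simp add: indicator_def sum.If_cases)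
      then show ?case using elim by simp
    qed
  qed auto
  also have "\<dots> = (\<Sum>k\<in>UNIV. \<P>(\<omega> in M. k \<in> S \<omega>))"
    by (subst Bochner_Integration.integral_sum)
       (auto intro!: sum.cong arg_cong[where f = prob] integrable_real_indicator simp: emeasure_eq_measure)
  also have "\<dots> = real CARD('n) * \<P>(\<omega> in M. i \<in> S \<omega>)"
    by (simp add: sum.cong[OF refl symm])
  finally show ?thesis by simp
qed

text \<open>The rescaled step size divides by this expectation.\<close>

lemma (in prob_space) uniform_random_subset_expectation_pos:
  fixes S :: "'a \<Rightarrow> 'n::finite set"
  assumes TS: "uniform_random_subset M T S"
  shows "expectation (\<lambda>\<omega>. real (T \<omega>)) > 0"
proof -
  have [measurable]: "T \<in> measurable M (count_space UNIV)"
    and ae: "AE \<omega> in M. T \<omega> \<in> {1..CARD('n)}"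
    using TS unfolding uniform_random_subset_def by auto
  have "integrable M (\<lambda>\<omega>. real (T \<omega>))"
    using ae by (intro integrable_const_bound[where B = "real CARD('n)"]) (auto elim: eventually_mono)
  then have "expectation (\<lambda>\<omega>. real (T \<omega>)) \<ge> 1"
    by (rule integral_ge_const) (use ae in \<open>auto elim: eventually_mono\<close>)
  then show ?thesis by simp
qed

section \<open>Straggler-tolerant block matrices\<close>

lemma sel_matrix_mult_nth: "(sel_matrix S ** A) $ i $ j = (if i \<in> S then A $ i $ j else 0)"
proof -
  have "sel_matrix S $ i $ k = (if i = k \<and> i \<in> S then 1 else 0)" for k
  proof -
    have "sel_matrix S $ i $ k = (\<Sum>j\<in>S. (if i = j then 1 else 0) * (if k = j then 1 else 0))"
      unfolding sel_matrix_def
      by (simp add: matrix_matrix_mult_def columnvector_def rowvector_def axis_def)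
    also have "\<dots> = (\<Sum>j\<in>S. if j = i then (if i = k then 1 else 0) else 0)"
      by (intro sum.cong) auto
    finally show ?thesis by simp
  qed
  then have "(sel_matrix S ** A) $ i $ j
      = (\<Sum>k\<in>UNIV. (if i = k \<and> i \<in> S then 1 else 0) * A $ k $ j)"
    by (simp add: matrix_matrix_mult_def)
  also have "\<dots> = (\<Sum>k\<in>UNIV. if k = i then (if i \<in> S then A $ i $ j else 0) else 0)"
    by (intro sum.cong) auto
  finally show ?thesis by simp
qed

lemma (in prob_space) integrable_fun_finite_type:
  fixes g :: "'b::finite \<Rightarrow> 'c::euclidean_space"
  assumes "X \<in> measurable M (count_space UNIV)"
  shows "integrable M (\<lambda>\<omega>. g (X \<omega>))"
proof -
  have "(\<lambda>\<omega>. g (X \<omega>)) \<in> borel_measurable M"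
    by (rule measurable_compose[OF assms]) simp
  moreover have "norm (g (X \<omega>)) \<le> (\<Sum>x\<in>UNIV. norm (g x))" for \<omega>
    by (rule member_le_sum) auto
  ultimately show ?thesis
    by (intro integrable_const_bound) auto
qed

text \<open>
  Left multiplication by the selection matrix keeps row \<open>k\<close> of \<open>A\<close> with probability
  \<open>E[T] / N\<close> and clears it otherwise; the step size \<open>(N / E[T]) \<nu>\<close> compensates
  for this.
\<close>

lemma (in prob_space) expectation_straggler_block_matrix:
  fixes S :: "'a \<Rightarrow> 'n::finite set" and A P :: "real^'n^'n"
  assumes TS: "uniform_random_subset M T S"
    and \<nu>h: "\<nu>h = real CARD('n) / expectation (\<lambda>\<omega>. real (T \<omega>)) * \<nu>"
  shows "expectation (\<lambda>\<omega>. block_matrix (P - \<nu>h *\<^sub>R (sel_matrix (S \<omega>) ** A)) Q R W)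
    = block_matrix (P - \<nu> *\<^sub>R A) Q R W"
proof -
  have [measurable]: "S \<in> measurable M (count_space UNIV)"
    using TS unfolding uniform_random_subset_def by blast
  let ?g = "\<lambda>U. block_matrix (P - \<nu>h *\<^sub>R (sel_matrix U ** A)) Q R W"
  have int: "integrable M (\<lambda>\<omega>. ?g (S \<omega>))"
    by (rule integrable_fun_finite_type) simp
  then have int1: "integrable M (\<lambda>\<omega>. ?g (S \<omega>) $ i)" for i
    by (simp add: integrable_vec_iff)
  have sel: "expectation (\<lambda>\<omega>. P $ k $ l - \<nu>h * (if k \<in> S \<omega> then A $ k $ l else 0))
      = P $ k $ l - \<nu> * A $ k $ l" for k l
  proof -
    have "expectation (\<lambda>\<omega>. P $ k $ l - \<nu>h * (if k \<in> S \<omega> then A $ k $ l else 0))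
      = expectation (\<lambda>\<omega>. P $ k $ l - \<nu>h * A $ k $ l * indicator {\<omega>\<in>space M. k \<in> S \<omega>} \<omega>)"
      by (intro Bochner_Integration.integral_cong) auto
    also have "\<dots> = P $ k $ l - \<nu>h * \<P>(\<omega> in M. k \<in> S \<omega>) * A $ k $ l"
      by (subst Bochner_Integration.integral_diff) (auto simp: prob_space emeasure_eq_measure)
    also have "\<nu>h * \<P>(\<omega> in M. k \<in> S \<omega>) = \<nu>"
      using uniform_random_subset_expectation_pos[OF TS]
      by (simp add: uniform_random_subset_inclusion_prob[OF TS] \<nu>h)
    finally show ?thesis .
  qed
  have "expectation (\<lambda>\<omega>. ?g (S \<omega>)) $ i $ j = block_matrix (P - \<nu> *\<^sub>R A) Q R W $ i $ j" for i j
    by (simp add: integral_vec_nth int int1)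
       (simp add: block_matrix_def sel_matrix_mult_nth sel prob_space split: sum.split)
  then show ?thesis by (simp add: vec_eq_iff)
qed

theorem theorem4p1:
  fixes A :: "real^'n^'n"
    and v :: "real^'n"
    and \<alpha> \<beta> \<eta> \<nu> \<rho> \<delta> \<nu>h :: real
    and M :: "'w measure"
    and T :: "'w \<Rightarrow> nat" and S :: "'w \<Rightarrow> 'n set"
    and Ts :: "nat \<Rightarrow> 'w \<Rightarrow> nat" and Ss :: "nat \<Rightarrow> 'w \<Rightarrow> 'n set"
    and C :: "real^('n + 'n)^('n + 'n)"
    and Ch :: "nat \<Rightarrow> 'w \<Rightarrow> real^('n + 'n)^('n + 'n)"
    and b d0 dh0 :: "real^('n + 'n)"
    and d :: "nat \<Rightarrow> real^('n + 'n)"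
    and dh :: "nat \<Rightarrow> 'w \<Rightarrow> real^('n + 'n)"
    and m :: nat
  assumes M: "prob_space M"
    and TS: "uniform_random_subset M T S"
    and copies: "iid_copies M T S Ts Ss"
    and A: "sym_pos_def A"
    and \<alpha>\<beta>: "0 < \<alpha>" "\<alpha> < \<beta>"
    and spectrum: "\<And>l. eigenvalue A l \<Longrightarrow> l \<in> {\<alpha>..\<beta>}"
    and \<rho>: "\<rho> = (\<alpha> + \<beta>) / (\<beta> - \<alpha>) - sqrt (((\<alpha> + \<beta>) / (\<beta> - \<alpha>))\<^sup>2 - 1)"
    and \<delta>: "\<delta> = (\<alpha> + \<beta>) / 2"
    and \<eta>: "\<eta> = \<rho>\<^sup>2"
    and \<nu>: "\<nu> = 2 * \<rho> / \<delta>"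
    and \<nu>h: "\<nu>h = real CARD('n) / (LINT \<omega>|M. real (T \<omega>)) * \<nu>"
    and C: "C = block_matrix ((1 + \<eta>) *\<^sub>R mat 1 - \<nu> *\<^sub>R A) (- (\<eta> *\<^sub>R mat 1)) (mat 1) 0"
    and Ch: "\<And>i \<omega>. Ch i \<omega> =
      block_matrix ((1 + \<eta>) *\<^sub>R mat 1 - \<nu>h *\<^sub>R (sel_matrix (Ss i \<omega>) ** A)) (- (\<eta> *\<^sub>R mat 1)) (mat 1) 0"
    and b: "b = \<nu> *\<^sub>R block_vec v 0"
    and d: "d 0 = d0" "\<And>i. i \<ge> 1 \<Longrightarrow> d i = C *v d (i - 1) + b"
    and dh: "\<And>\<omega>. \<omega> \<in> space M \<Longrightarrow> dh 0 \<omega> = dh0"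
      "\<And>i \<omega>. i \<ge> 1 \<Longrightarrow> \<omega> \<in> space M \<Longrightarrow> dh i \<omega> = Ch i \<omega> *v dh (i - 1) \<omega> + b"
    and m: "m \<ge> 1"
  shows "d m = matpow C m *v d0 + (\<Sum>k<m. matpow C k) *v b \<and>
    (\<forall>\<omega>\<in>space M. dh m \<omega> = matprod (\<lambda>i. Ch i \<omega>) 1 m *v dh0
       + (mat 1 + (\<Sum>j=2..m. matprod (\<lambda>i. Ch i \<omega>) j m)) *v b) \<and>
    (\<forall>f. dh0 = f \<and> d0 = f \<longrightarrow> integrable M (dh m) \<and> (LINT \<omega>|M. dh m \<omega>) = d m)"
proof -
  interpret prob_space M by (rule M)
  have d_orbit: "d m = affine_orbit (\<lambda>_. C) b d0 m"
    by (rule affine_orbitI) (use d in auto)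
  have dh_orbit: "dh m \<omega> = affine_orbit (\<lambda>i. Ch i \<omega>) b dh0 m" if "\<omega> \<in> space M" for \<omega>
    using affine_orbitI[of "\<lambda>i. dh i \<omega>" dh0 "\<lambda>i. Ch i \<omega>" b m] dh that by auto

  define g where "g U = block_matrix ((1 + \<eta>) *\<^sub>R mat 1 - \<nu>h *\<^sub>R (sel_matrix U ** A))
      (- (\<eta> *\<^sub>R mat 1)) (mat 1) 0" for U
  have Ch_g: "Ch = (\<lambda>i \<omega>. g (Ss i \<omega>))"
    by (simp add: fun_eq_iff Ch g_def)
  have pairs: "indep_vars (\<lambda>_. count_space UNIV) (\<lambda>i \<omega>. (Ts i \<omega>, Ss i \<omega>)) {1..}"
    and same: "\<And>i. i \<ge> 1 \<Longrightarrow> distr M (count_space UNIV) (\<lambda>\<omega>. (Ts i \<omega>, Ss i \<omega>))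
        = distr M (count_space UNIV) (\<lambda>\<omega>. (T \<omega>, S \<omega>))"
    using copies unfolding iid_copies_def by blast+
  have meas_i: "(\<lambda>\<omega>. (Ts i \<omega>, Ss i \<omega>)) \<in> measurable M (count_space UNIV)" if "i \<ge> 1" for i
    using pairs that unfolding indep_vars_def by auto
  have [measurable]: "T \<in> measurable M (count_space UNIV)" "S \<in> measurable M (count_space UNIV)"
    using TS unfolding uniform_random_subset_def by blast+
  have meas: "(\<lambda>\<omega>. (T \<omega>, S \<omega>)) \<in> measurable M (count_space UNIV)"
    by measurable

  have ind: "indep_vars (\<lambda>_. borel) Ch {1..}"
    using indep_vars_compose2[OF pairs, of "\<lambda>_ p. g (snd p)" "\<lambda>_. borel"] by (simp add: Ch_g)
  have int: "integrable M (Ch i)" if "i \<ge> 1" for i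
    unfolding Ch_g
    by (rule integrable_fun_finite_type)
       (use measurable_compose[OF meas_i[OF that], of snd] in simp)
  have mean: "expectation (Ch i) = C" if "i \<ge> 1" for i
  proof -
    have "expectation (Ch i) = (\<integral>p. g (snd p) \<partial>distr M (count_space UNIV) (\<lambda>\<omega>. (Ts i \<omega>, Ss i \<omega>)))"
      using meas_i[OF that] by (subst integral_distr) (auto simp: Ch_g)
    also have "\<dots> = expectation (\<lambda>\<omega>. g (S \<omega>))"
      unfolding same[OF that] using meas by (subst integral_distr) auto
    also have "\<dots> = C"
      unfolding g_def C by (rule expectation_straggler_block_matrix[OF TS \<nu>h])
    finally show ?thesis .
  qed

  have "affine_orbit (\<lambda>i. expectation (Ch i)) b f m = affine_orbit (\<lambda>_. C) b f m" for f
    by (rule affine_orbit_cong) (simp add: mean)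
  then have orbit_mean: "integrable M (\<lambda>\<omega>. affine_orbit (\<lambda>i. Ch i \<omega>) b f m) \<and>
      expectation (\<lambda>\<omega>. affine_orbit (\<lambda>i. Ch i \<omega>) b f m) = affine_orbit (\<lambda>_. C) b f m" for f
    using expectation_affine_orbit[OF ind int, of b f m] by simp

  have "d m = matpow C m *v d0 + (\<Sum>k<m. matpow C k) *v b"
    by (simp add: d_orbit affine_orbit_const)
  moreover have "dh m \<omega> = matprod (\<lambda>i. Ch i \<omega>) 1 m *v dh0
       + (mat 1 + (\<Sum>j=2..m. matprod (\<lambda>i. Ch i \<omega>) j m)) *v b" if "\<omega> \<in> space M" for \<omega>
    using m by (simp add: dh_orbit[OF that] affine_orbit_closed_form matprod_empty add.commute)
  moreover have "integrable M (dh m) \<and> expectation (dh m) = d m" if "dh0 = d0"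
  proof -
    have "integrable M (dh m) \<longleftrightarrow> integrable M (\<lambda>\<omega>. affine_orbit (\<lambda>i. Ch i \<omega>) b d0 m)"
      "expectation (dh m) = expectation (\<lambda>\<omega>. affine_orbit (\<lambda>i. Ch i \<omega>) b d0 m)"
      using dh_orbit that
      by (auto intro!: Bochner_Integration.integrable_cong Bochner_Integration.integral_cong)
    with orbit_mean[of d0] show ?thesis by (simp add: d_orbit)
  qed
  ultimately show ?thesis by blast
qed

end
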